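(* Let $\alpha\in\mathcal{CP}_n$ with kernel blocks $A_1,\ldots,A_p$ ($1\le p\le n$) and $A_i\alpha=\{x_i\}$ for $1\le i\le p$. Then $\alpha$ is a regular element of the semigroup $\mathcal{CP}_n$ if and only if there exists an admissible transversal $T_\alpha=\{t_1,\ldots,t_p\}$ ($t_i\in A_i$) of $\mathbf{Ker}\,\alpha$ such that $|t_j-t_i|=|t_j\alpha-t_i\alpha|$ for all $i,j\in\{1,\ldots,p\}$. Equivalently, $\alpha$ is regular in $\mathcal{CP}_n$ if and only if there exists an admissible transversal $T_\alpha=\{t_1,\ldots,t_p\}$ of $\mathbf{Ker}\,\alpha$ such that the map $t_i\mapsto x_i$ ($1\le i\le p$) is an isometry.
   Context: $[n]=\{1,\ldots,n\}$. $\mathcal{P}_n$ is the semigroup of all partial transformations of $[n]$ (maps whose domain and image are subsets of $[n]$), written on the right and composed left to right: $x(\alpha\beta)=(x\alpha)\beta$. $\mathcal{CP}_n=\{\alpha\in\mathcal{P}_n : |x\alpha-y\alpha|\le|x-y| \text{ for all } x,y\in\mathrm{Dom}\,\alpha\}$ is the subsemigroup of partial contractions. For $\alpha\in\mathcal{P}_n$, $\mathbf{Ker}\,\alpha=\{A_1,\ldots,A_p\}$ is the partition of $\mathrm{Dom}\,\alpha$ into the nonempty fibres of $\alpha$ (classes of $x\sim y\iff x\alpha=y\alpha$), and $x_i$ is the common image of the elements of $A_i$. A transversal of $\mathbf{Ker}\,\alpha$ is a set $T_\alpha=\{t_1,\ldots,t_p\}$ with $t_i\in A_i$ for each $i$ (exactly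 one element from each block). It is admissible if $|t_i-t_j|\le|a_i-a_j|$ for all $i,j$ and all $a_i\in A_i$, $a_j\in A_j$. An isometry is a map preserving the distance $|x-y|$. An element $a$ of a semigroup $S$ is regular if $a=aa'a$ for some $a'\in S$. *)

theory Defs
  imports Main
begin

type_synonym ptrans = "nat \<rightharpoonup> nat"

definition PT :: "nat \<Rightarrow> ptrans set" where
  "PT n = {\<alpha>. dom \<alpha> \<subseteq> {1..n} \<and> ran \<alpha> \<subseteq> {1..n}}"

text \<open>Maps act on the right: \<open>x \<cdot> \<alpha>\<close> is the image of \<open>x\<close> under \<open>\<alpha>\<close>, meaningful only for
  \<open>x \<in> dom \<alpha>\<close>; products are composed from left to right.\<close>

definition act :: "nat \<Rightarrow> ptrans \<Rightarrow> nat" (infixl "\<cdot>" 75) where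
  "x \<cdot> \<alpha> = the (\<alpha> x)"

definition pmult :: "ptrans \<Rightarrow> ptrans \<Rightarrow> ptrans" (infixl "\<bullet>" 70) where
  "\<alpha> \<bullet> \<beta> = \<beta> \<circ>\<^sub>m \<alpha>"

definition CP :: "nat \<Rightarrow> ptrans set" where
  "CP n = {\<alpha> \<in> PT n. \<forall>x\<in>dom \<alpha>. \<forall>y\<in>dom \<alpha>.
     \<bar>int (x \<cdot> \<alpha>) - int (y \<cdot> \<alpha>)\<bar> \<le> \<bar>int x - int y\<bar>}"

definition regular_in :: "'a set \<Rightarrow> ('a \<Rightarrow> 'a \<Rightarrow> 'a) \<Rightarrow> 'a \<Rightarrow> bool" where
  "regular_in S f a \<longleftrightarrow> a \<in> S \<and> (\<exists>a'\<in>S. a = f (f a a') a)"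

definition ker_rel :: "ptrans \<Rightarrow> (nat \<times> nat) set" where
  "ker_rel \<alpha> = {(x, y). x \<in> dom \<alpha> \<and> y \<in> dom \<alpha> \<and> x \<cdot> \<alpha> = y \<cdot> \<alpha>}"

definition Ker :: "ptrans \<Rightarrow> nat set set" where
  "Ker \<alpha> = dom \<alpha> // ker_rel \<alpha>"

definition transversal :: "nat set set \<Rightarrow> nat set \<Rightarrow> bool" where
  "transversal P T \<longleftrightarrow> T \<subseteq> \<Union>P \<and> (\<forall>A\<in>P. \<exists>!t. t \<in> T \<inter> A)"

definition admissible :: "nat set set \<Rightarrow> nat set \<Rightarrow> bool" where
  "admissible P T \<longleftrightarrow> transversal P T \<and>
     (\<forall>A\<in>P. \<forall>B\<in>P. \<forall>s\<in>T \<inter> A. \<forall>t\<in>T \<inter> B. \<forall>a\<in>A. \<forall>b\<in>B.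
        \<bar>int s - int t\<bar> \<le> \<bar>int a - int b\<bar>)"

definition isometry :: "ptrans \<Rightarrow> bool" where
  "isometry \<gamma> \<longleftrightarrow> (\<forall>x\<in>dom \<gamma>. \<forall>y\<in>dom \<gamma>.
     \<bar>int (x \<cdot> \<gamma>) - int (y \<cdot> \<gamma>)\<bar> = \<bar>int x - int y\<bar>)"

lemma act_pmult: "x \<in> dom (\<alpha> \<bullet> \<beta>) \<Longrightarrow> x \<cdot> (\<alpha> \<bullet> \<beta>) = (x \<cdot> \<alpha>) \<cdot> \<beta>"
  by (auto simp: act_def pmult_def map_comp_def split: option.splits)

lemma pmult_assoc: "(\<alpha> \<bullet> \<beta>) \<bullet> \<gamma> = \<alpha> \<bullet> (\<beta> \<bullet> \<gamma>)"
  by (auto simp: pmult_def map_comp_def fun_eq_iff split: option.splits)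

lemma PT_closed: "\<alpha> \<in> PT n \<Longrightarrow> \<beta> \<in> PT n \<Longrightarrow> \<alpha> \<bullet> \<beta> \<in> PT n"
  by (fastforce simp: PT_def pmult_def map_comp_def dom_def ran_def split: option.splits)

lemma CP_closed:
  assumes "\<alpha> \<in> CP n" "\<beta> \<in> CP n"
  shows "\<alpha> \<bullet> \<beta> \<in> CP n"
proof -
  have d: "x \<in> dom \<alpha>" "x \<cdot> \<alpha> \<in> dom \<beta>" if "x \<in> dom (\<alpha> \<bullet> \<beta>)" for x
    using that by (auto simp: act_def pmult_def map_comp_def split: option.splits)
  have "\<bar>int (x \<cdot> (\<alpha> \<bullet> \<beta>)) - int (y \<cdot> (\<alpha> \<bullet> \<beta>))\<bar> \<le> \<bar>int x - int y\<bar>"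
    if x: "x \<in> dom (\<alpha> \<bullet> \<beta>)" and y: "y \<in> dom (\<alpha> \<bullet> \<beta>)" for x y
  proof -
    have "\<bar>int (x \<cdot> \<alpha> \<cdot> \<beta>) - int (y \<cdot> \<alpha> \<cdot> \<beta>)\<bar> \<le> \<bar>int (x \<cdot> \<alpha>) - int (y \<cdot> \<alpha>)\<bar>"
      using assms(2) d(2)[OF x] d(2)[OF y] by (simp add: CP_def)
    also have "\<dots> \<le> \<bar>int x - int y\<bar>"
      using assms(1) d(1)[OF x] d(1)[OF y] by (simp add: CP_def)
    finally show ?thesis by (simp add: act_pmult x y)
  qed
  then show ?thesis using assms PT_closed by (simp add: CP_def)
qed

lemma equiv_ker_rel: "equiv (dom \<alpha>) (ker_rel \<alpha>)"
  by (rule equivI) (auto simp: ker_rel_def refl_on_def sym_def trans_def)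

end

(* If \<alpha> = \<alpha>\<beta>\<alpha>, then t_i = x_i \<beta> lies in A_i, and chaining the contractions \<beta> and \<alpha> gives
   |t_i - t_j| \<le> |x_i - x_j| \<le> |a_i - a_j| for all a_i in A_i and a_j in A_j; this is admissibility, and the
   choice a_i = t_i, a_j = t_j turns it into an isometry. Conversely, the inverse x_i \<mapsto> t_i of an isometry
   t_i \<mapsto> x_i is itself a partial contraction, and it is an inverse of \<alpha>. *)

theory Submission
  imports Defs
begin

text \<open>A kernel class is generated by any of its members. This trades classes of the quotient
  for fibres of \<open>\<alpha>\<close>, where membership is an equation between images.\<close>

lemma Ker_block_eq:
  assumes "B \<in> Ker \<alpha>" and "a \<in> B"
  shows "B = {b \<in> dom \<alpha>. b \<cdot> \<alpha> = a \<cdot> \<alpha>}"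
  using assms by (auto simp: Ker_def quotient_def ker_rel_def)

lemma Union_Ker: "\<Union>(Ker \<alpha>) = dom \<alpha>"
  unfolding Ker_def by (rule Union_quotient[OF equiv_ker_rel])

lemma act_in_dom: "x \<in> dom \<alpha> \<Longrightarrow> \<alpha> x = Some (x \<cdot> \<alpha>)"
  by (auto simp: act_def)

text \<open>Outside \<open>dom \<alpha>\<close> both sides are undefined, so only points of
  \<open>dom \<alpha>\<close> matter. The domain conditions appear separately because
  \<open>act\<close> has an unspecified value where a map is undefined, so equality of values alone
  would not show that the composite is defined.\<close>

lemma pmult_inverse_iff:
  "\<alpha> = \<alpha> \<bullet> \<beta> \<bullet> \<alpha> \<longleftrightarrow>
     (\<forall>a\<in>dom \<alpha>. a \<cdot> \<alpha> \<in> dom \<beta> \<and> a \<cdot> \<alpha> \<cdot> \<beta> \<in> dom \<alpha> \<and> a \<cdot> \<alpha> \<cdot> \<beta> \<cdot> \<alpha> = a \<cdot> \<alpha>)"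
proof
  assume eq: "\<alpha> = \<alpha> \<bullet> \<beta> \<bullet> \<alpha>"
  show "\<forall>a\<in>dom \<alpha>. a \<cdot> \<alpha> \<in> dom \<beta> \<and> a \<cdot> \<alpha> \<cdot> \<beta> \<in> dom \<alpha> \<and> a \<cdot> \<alpha> \<cdot> \<beta> \<cdot> \<alpha> = a \<cdot> \<alpha>"
  proof
    fix a assume "a \<in> dom \<alpha>"
    then obtain y where y: "\<alpha> a = Some y" by blast
    then have "(\<alpha> \<bullet> \<beta> \<bullet> \<alpha>) a = Some y" using eq[symmetric] by simp
    then obtain z where "\<beta> y = Some z" "\<alpha> z = Some y"
      using y by (auto simp: pmult_def map_comp_def split: option.splits)
    then show "a \<cdot> \<alpha> \<in> dom \<beta> \<and> a \<cdot> \<alpha> \<cdot> \<beta> \<in> dom \<alpha> \<and> a \<cdot> \<alpha> \<cdot> \<beta> \<cdot> \<alpha> = a \<cdot> \<alpha>"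
      using y by (auto simp: act_def)
  qed
next
  assume *: "\<forall>a\<in>dom \<alpha>. a \<cdot> \<alpha> \<in> dom \<beta> \<and> a \<cdot> \<alpha> \<cdot> \<beta> \<in> dom \<alpha> \<and> a \<cdot> \<alpha> \<cdot> \<beta> \<cdot> \<alpha> = a \<cdot> \<alpha>"
  show "\<alpha> = \<alpha> \<bullet> \<beta> \<bullet> \<alpha>"
  proof
    fix a
    show "\<alpha> a = (\<alpha> \<bullet> \<beta> \<bullet> \<alpha>) a"
    proof (cases "\<alpha> a")
      case None
      then show ?thesis by (simp add: pmult_def)
    next
      case (Some y)
      then have "a \<in> dom \<alpha>" and "a \<cdot> \<alpha> = y" by (auto simp: act_def)
      with * have "y \<in> dom \<beta>" "y \<cdot> \<beta> \<in> dom \<alpha>" "y \<cdot> \<beta> \<cdot> \<alpha> = y" by metis+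
      then have "\<beta> y = Some (y \<cdot> \<beta>)" "\<alpha> (y \<cdot> \<beta>) = Some y"
        using act_in_dom[of y \<beta>] act_in_dom[of "y \<cdot> \<beta>" \<alpha>] by simp_all
      with Some show ?thesis by (simp add: pmult_def)
    qed
  qed
qed

lemma CP_contraction:
  assumes "\<alpha> \<in> CP n" "a \<in> dom \<alpha>" "b \<in> dom \<alpha>"
  shows "\<bar>int (a \<cdot> \<alpha>) - int (b \<cdot> \<alpha>)\<bar> \<le> \<bar>int a - int b\<bar>"
  using assms by (simp add: CP_def)

lemma act_range: "\<alpha> \<in> PT n \<Longrightarrow> a \<in> dom \<alpha> \<Longrightarrow> a \<cdot> \<alpha> \<in> {1..n}"
  by (force simp: PT_def act_def ran_def)

theorem theorem2p1:
  fixes n p :: nat and \<alpha> :: ptrans and A :: "nat \<Rightarrow> nat set" and x :: "nat \<Rightarrow> nat"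
  assumes "\<alpha> \<in> CP n"
    and "1 \<le> p" and "p \<le> n"
    and "bij_betw A {1..p} (Ker \<alpha>)"
    and "\<And>i. i \<in> {1..p} \<Longrightarrow> (\<lambda>a. a \<cdot> \<alpha>) ` A i = {x i}"
  shows "(regular_in (CP n) (\<bullet>) \<alpha> \<longleftrightarrow>
            (\<exists>T t. admissible (Ker \<alpha>) T \<and> T = t ` {1..p} \<and> (\<forall>i\<in>{1..p}. t i \<in> A i) \<and>
               (\<forall>i\<in>{1..p}. \<forall>j\<in>{1..p}.
                  \<bar>int (t j) - int (t i)\<bar> = \<bar>int (t j \<cdot> \<alpha>) - int (t i \<cdot> \<alpha>)\<bar>)))
       \<and> (regular_in (CP n) (\<bullet>) \<alpha> \<longleftrightarrow>
            (\<exists>T t. admissible (Ker \<alpha>) T \<and> T = t ` {1..p} \<and> (\<forall>i\<in>{1..p}. t i \<in> A i) \<and>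
               (\<exists>\<gamma>. Map.graph \<gamma> = {(t i, x i) | i. i \<in> {1..p}} \<and> isometry \<gamma>)))"
proof -
  let ?I = "{1..p}"
  let ?iso = "\<lambda>t. \<forall>i\<in>?I. \<forall>j\<in>?I. \<bar>int (t j) - int (t i)\<bar> = \<bar>int (t j \<cdot> \<alpha>) - int (t i \<cdot> \<alpha>)\<bar>"
  have Ker: "Ker \<alpha> = A ` ?I" and injA: "inj_on A ?I"
    using assms(4) by (auto simp: bij_betw_def)
  \<comment> \<open>The singleton image forces \<open>A i\<close> to be nonempty, and any of its
    points then shows the block to be the whole fibre over \<open>x i\<close>.\<close>
  have block: "A i = {a \<in> dom \<alpha>. a \<cdot> \<alpha> = x i}" if i: "i \<in> ?I" for i
  proof -
    obtain a where a: "a \<in> A i" "a \<cdot> \<alpha> = x i" using assms(5)[OF i] by blast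
    with Ker_block_eq[of "A i" \<alpha> a] i show ?thesis by (auto simp: Ker)
  qed
  have dom: "dom \<alpha> = (\<Union>i\<in>?I. A i)"
    using Union_Ker[of \<alpha>] by (simp add: Ker)
  \<comment> \<open>The fibre over \<open>x i\<close> determines the block, and distinct indices
    carry distinct blocks. This makes the assignment of \<open>t i\<close> to \<open>x i\<close>
    well defined later on.\<close>
  have injx: "inj_on x ?I"
  proof (rule inj_onI)
    fix i j assume "i \<in> ?I" "j \<in> ?I" "x i = x j"
    moreover from this have "A i = A j" by (simp add: block)
    ultimately show "i = j" using injA by (blast dest: inj_onD)
  qed
  have same_block: "i = j" if "i \<in> ?I" "j \<in> ?I" "a \<in> A i" "a \<in> A j" for i j a
  proof -
    have "x i = x j" using that(3,4) block[OF that(1)] block[OF that(2)] by simp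
    then show ?thesis using injx that(1,2) by (blast dest: inj_onD)
  qed
  have \<alpha>: "\<alpha> \<in> PT n" using assms(1) by (simp add: CP_def)

  have transv: "transversal (Ker \<alpha>) (t ` ?I)" if t: "\<forall>i\<in>?I. t i \<in> A i" for t
  proof -
    have "t ` ?I \<inter> A i = {t i}" if i: "i \<in> ?I" for i
      using t i same_block by blast
    moreover have "t ` ?I \<subseteq> dom \<alpha>" using t dom by blast
    \<comment> \<open>\<open>Int_iff\<close> is removed so that the intersection with a block stays
      intact and rewrites to a singleton, which settles existence and uniqueness at once.\<close>
    ultimately show ?thesis
      unfolding transversal_def Union_Ker by (simp add: Ker del: Int_iff)
  qed

  have regular_imp: "\<exists>t. admissible (Ker \<alpha>) (t ` ?I) \<and> (\<forall>i\<in>?I. t i \<in> A i) \<and> ?iso t"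
    if reg: "regular_in (CP n) (\<bullet>) \<alpha>"
  proof -
    obtain \<beta> where \<beta>: "\<beta> \<in> CP n" and eq: "\<alpha> = \<alpha> \<bullet> \<beta> \<bullet> \<alpha>"
      using reg unfolding regular_in_def by blast
    define t where "t i = x i \<cdot> \<beta>" for i
    \<comment> \<open>\<open>x i\<close> is the image of some \<open>a\<close> in
      \<open>A i\<close>; evaluating the identity at \<open>a\<close> shows that
      \<open>\<beta>\<close> is defined at \<open>x i\<close> and that \<open>\<alpha>\<close> sends
      \<open>t i\<close> back to \<open>x i\<close>.\<close>
    have x: "x i \<in> dom \<beta> \<and> t i \<in> A i" if i: "i \<in> ?I" for i
    proof -
      obtain a where "a \<in> A i" using assms(5)[OF i] by blast
      then have a: "a \<in> dom \<alpha>" "a \<cdot> \<alpha> = x i" using block[OF i] by auto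
      show ?thesis
        using bspec[OF eq[unfolded pmult_inverse_iff] a(1)] a(2) block[OF i] by (simp add: t_def)
    qed
    have le: "\<bar>int (t i) - int (t j)\<bar> \<le> \<bar>int (x i) - int (x j)\<bar>" if "i \<in> ?I" "j \<in> ?I" for i j
      unfolding t_def using CP_contraction[OF \<beta>] x that by blast
    have ge: "\<bar>int (x i) - int (x j)\<bar> \<le> \<bar>int a - int b\<bar>"
      if "i \<in> ?I" "j \<in> ?I" "a \<in> A i" "b \<in> A j" for i j a b
      using CP_contraction[OF assms(1), of a b] block that by auto
    have iso: "?iso t"
    proof (intro ballI)
      fix i j assume ij: "i \<in> ?I" "j \<in> ?I"
      then have "t i \<cdot> \<alpha> = x i" "t j \<cdot> \<alpha> = x j" using x block by auto
      then show "\<bar>int (t j) - int (t i)\<bar> = \<bar>int (t j \<cdot> \<alpha>) - int (t i \<cdot> \<alpha>)\<bar>"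
        using le[OF ij(2,1)] ge[OF ij(2,1), of "t j" "t i"] x ij by simp
    qed
    have "admissible (Ker \<alpha>) (t ` ?I)"
      unfolding admissible_def
    proof (intro conjI ballI)
      show "transversal (Ker \<alpha>) (t ` ?I)" using transv x by blast
    next
      fix B C s u a b
      assume BC: "B \<in> Ker \<alpha>" "C \<in> Ker \<alpha>" and su: "s \<in> t ` ?I \<inter> B" "u \<in> t ` ?I \<inter> C"
        and ab: "a \<in> B" "b \<in> C"
      \<comment> \<open>The points \<open>s\<close> and \<open>u\<close> come with indices
        \<open>k\<close> and \<open>l\<close>, their blocks with indices \<open>i\<close> and
        \<open>j\<close>. Disjointness of the blocks identifies them.\<close>
      obtain k l where kl: "k \<in> ?I" "l \<in> ?I" "s = t k" "u = t l" using su by auto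
      obtain i j where ij: "i \<in> ?I" "j \<in> ?I" "B = A i" "C = A j" using BC by (auto simp: Ker)
      have "t k \<in> A i" "t l \<in> A j" using su kl ij by simp_all
      then have "k = i" "l = j"
        using same_block[of k i "t k"] same_block[of l j "t l"] kl ij x by simp_all
      then show "\<bar>int s - int u\<bar> \<le> \<bar>int a - int b\<bar>"
        using le[OF ij(1,2)] ge[OF ij(1,2), of a b] kl ij ab by simp
    qed
    with iso x show ?thesis by blast
  qed

  have imp_regular: "regular_in (CP n) (\<bullet>) \<alpha>"
    if t: "\<forall>i\<in>?I. t i \<in> A i" and iso: "?iso t" for t
  proof -
    have t\<alpha>: "t i \<in> dom \<alpha>" "t i \<cdot> \<alpha> = x i" if "i \<in> ?I" for i
      using t block that by auto
    \<comment> \<open>\<open>\<beta>\<close> is defined only at the points \<open>x i\<close>,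
      through the inverse of the injective \<open>x\<close>. The contraction condition thus concerns
      pairs \<open>x i\<close>, \<open>x j\<close> alone, where \<open>?iso t\<close> gives it with
      equality.\<close>
    define \<beta> where "\<beta> y = (if y \<in> x ` ?I then Some (t (the_inv_into ?I x y)) else None)" for y
    have dom\<beta>: "dom \<beta> = x ` ?I" by (auto simp: \<beta>_def split: if_splits)
    have \<beta>x: "\<beta> (x i) = Some (t i)" "x i \<cdot> \<beta> = t i" if "i \<in> ?I" for i
      using that the_inv_into_f_f[OF injx that] by (simp_all add: \<beta>_def act_def)
    \<comment> \<open>The domain of \<open>\<beta>\<close> consists of values of
      \<open>\<alpha>\<close> and its range of points of \<open>dom \<alpha>\<close>, so both bounds
      are inherited from \<open>\<alpha>\<close>.\<close>
    have "dom \<beta> \<subseteq> {1..n}"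
      unfolding dom\<beta>
    proof (rule image_subsetI)
      fix i assume "i \<in> ?I"
      then show "x i \<in> {1..n}" using act_range[OF \<alpha> t\<alpha>(1)] by (simp add: t\<alpha>(2))
    qed
    moreover have "ran \<beta> \<subseteq> {1..n}"
    proof
      fix z assume "z \<in> ran \<beta>"
      then obtain y where y: "\<beta> y = Some z" by (auto simp: ran_def)
      then obtain i where "i \<in> ?I" "y = x i" using dom\<beta> by blast
      with y \<beta>x have "z = t i" by simp
      then show "z \<in> {1..n}" using t\<alpha> \<open>i \<in> ?I\<close> \<alpha> unfolding PT_def by blast
    qed
    ultimately have "\<beta> \<in> CP n"
      using iso by (simp add: CP_def PT_def dom\<beta> \<beta>x t\<alpha> abs_minus_commute)
    \<comment> \<open>Each \<open>a\<close> in \<open>A i\<close> travels to \<open>x i\<close>,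
      then to \<open>t i\<close>, then back to \<open>x i\<close>.\<close>
    moreover have "\<alpha> = \<alpha> \<bullet> \<beta> \<bullet> \<alpha>"
      unfolding pmult_inverse_iff
    proof
      fix a assume "a \<in> dom \<alpha>"
      then obtain i where i: "i \<in> ?I" "a \<in> A i" using dom by blast
      then have "a \<cdot> \<alpha> = x i" using block by blast
      then show "a \<cdot> \<alpha> \<in> dom \<beta> \<and> a \<cdot> \<alpha> \<cdot> \<beta> \<in> dom \<alpha> \<and> a \<cdot> \<alpha> \<cdot> \<beta> \<cdot> \<alpha> = a \<cdot> \<alpha>"
        using dom\<beta> \<beta>x(2)[OF i(1)] t\<alpha>[OF i(1)] i(1) by simp
    qed
    ultimately show ?thesis using assms(1) unfolding regular_in_def by blast
  qed

  have iso_iff: "?iso t \<longleftrightarrow> (\<exists>\<gamma>. Map.graph \<gamma> = {(t i, x i) | i. i \<in> ?I} \<and> isometry \<gamma>)"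
    if t: "\<forall>i\<in>?I. t i \<in> A i" for t
  proof -
    have t\<alpha>: "t i \<in> dom \<alpha>" "t i \<cdot> \<alpha> = x i" "\<alpha> (t i) = Some (x i)" if "i \<in> ?I" for i
    proof -
      have "t i \<in> {a \<in> dom \<alpha>. a \<cdot> \<alpha> = x i}" using t that block[OF that] by blast
      then show "t i \<in> dom \<alpha>" "t i \<cdot> \<alpha> = x i" "\<alpha> (t i) = Some (x i)"
        using act_in_dom[of "t i" \<alpha>] by simp_all
    qed
    \<comment> \<open>The graph fixes the domain and all values of \<open>\<gamma>\<close>, so being
      an isometry depends on \<open>t\<close> alone.\<close>
    have graph: "isometry \<gamma> \<longleftrightarrow> ?iso t" if \<gamma>: "Map.graph \<gamma> = {(t i, x i) | i. i \<in> ?I}" for \<gamma>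
    proof -
      have val: "\<gamma> (t i) = Some (x i)" if "i \<in> ?I" for i
        using \<gamma> that by (auto simp: Map.graph_def)
      have "dom \<gamma> = t ` ?I"
        using \<gamma> by (fastforce simp: Map.graph_def)
      moreover have "t i \<cdot> \<gamma> = x i" if "i \<in> ?I" for i
        using val[OF that] by (simp add: act_def)
      ultimately show ?thesis
        by (auto simp: isometry_def t\<alpha>)
    qed
    \<comment> \<open>The witness for \<open>\<gamma>\<close> is the restriction of
      \<open>\<alpha>\<close> to the transversal.\<close>
    have "Map.graph (\<alpha> |` (t ` ?I)) = {(t i, x i) | i. i \<in> ?I}"
      using t\<alpha>(3) by (fastforce simp: Map.graph_def restrict_map_def split: if_splits)
    with graph show ?thesis by blast
  qed

  have first: "regular_in (CP n) (\<bullet>) \<alpha> \<longleftrightarrow>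
      (\<exists>T t. admissible (Ker \<alpha>) T \<and> T = t ` ?I \<and> (\<forall>i\<in>?I. t i \<in> A i) \<and> ?iso t)"
  proof
    assume "regular_in (CP n) (\<bullet>) \<alpha>"
    from regular_imp[OF this] obtain t
      where "admissible (Ker \<alpha>) (t ` ?I)" "\<forall>i\<in>?I. t i \<in> A i" "?iso t" by (elim exE conjE)
    then show "\<exists>T t. admissible (Ker \<alpha>) T \<and> T = t ` ?I \<and> (\<forall>i\<in>?I. t i \<in> A i) \<and> ?iso t"
      by (intro exI[of _ "t ` ?I"] exI[of _ t] conjI) (assumption | rule refl)+
  next
    assume "\<exists>T t. admissible (Ker \<alpha>) T \<and> T = t ` ?I \<and> (\<forall>i\<in>?I. t i \<in> A i) \<and> ?iso t"
    then show "regular_in (CP n) (\<bullet>) \<alpha>" by (elim exE conjE) (rule imp_regular)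
  qed
  show ?thesis
    \<comment> \<open>\<open>iso_iff\<close> is conditional on each \<open>t i\<close> lying in
      \<open>A i\<close>; \<open>conj_cong\<close> supplies that conjunct while the last one is
      rewritten.\<close>
    by (rule conjI[OF first]) (simp only: first iso_iff cong: conj_cong)
qed

end
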